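(* Let $S$ be a numerical monoid with $S\ne\mathbb N_0$. (1) The monoid $\mathcal P_{\mathrm{fin}}(S)$ has no prime elements. (2) If $\mathcal P_{\mathrm{fin}}(S)=H_1\oplus H_2$ for some submonoids $H_1$ and $H_2$, then $H_1=\{\{0\}\}$ or $H_2=\{\{0\}\}$. (3) If $S'$ is a numerical monoid such that $\mathcal P_{\mathrm{fin}}(S')$ is isomorphic (as a monoid) to $\mathcal P_{\mathrm{fin}}(S)$, then $S=S'$.
   Context: A numerical monoid is an additive submonoid $S\subset\mathbb N_0$ with $\gcd(S)=1$. $\mathcal P_{\mathrm{fin}}(S)$ is the set of all finite nonempty subsets of $S$ with set addition $A+B=\{a+b\colon a\in A,b\in B\}$ as operation; its identity is $\{0\}$, its only invertible element. $A$ divides $B$ if $B=A+C$ for some $C\in\mathcal P_{\mathrm{fin}}(S)$. An element $P$ is prime if $P\ne\{0\}$ and whenever $P$ divides $A+B$ then $P$ divides $A$ or $P$ divides $B$. For submonoids $H_1,H_2$, $H=H_1\oplus H_2$ means every element of $H$ is uniquely $h_1+h_2$ with $h_i\in H_i$. *)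

theory Defs
  imports "HOL-Algebra.Divisibility" "HOL-Library.Set_Algebras"
begin

definition numerical_monoid :: "nat set \<Rightarrow> bool" where
  "numerical_monoid S \<longleftrightarrow>
     0 \<in> S \<and> (\<forall>a\<in>S. \<forall>b\<in>S. a + b \<in> S) \<and> Gcd S = 1"

text \<open>The operation is the set addition of \<^theory>\<open>HOL-Library.Set_Algebras\<close>. The monoid is
  written multiplicatively in HOL-Algebra, so its product is the sumset.\<close>

definition power_monoid :: "nat set \<Rightarrow> nat set monoid" (\<open>\<P>\<^sub>f\<^sub>i\<^sub>n\<close>) where
  "\<P>\<^sub>f\<^sub>i\<^sub>n S = \<lparr>carrier = {A. A \<subseteq> S \<and> finite A \<and> A \<noteq> {}}, mult = (\<lambda>A B. A + B), one = {0}\<rparr>"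

definition is_direct_sum :: "('a, 'b) monoid_scheme \<Rightarrow> 'a set \<Rightarrow> 'a set \<Rightarrow> bool" where
  "is_direct_sum G H1 H2 \<longleftrightarrow>
     submonoid H1 G \<and> submonoid H2 G \<and>
     (\<forall>h\<in>carrier G. \<exists>!p. p \<in> H1 \<times> H2 \<and> h = fst p \<otimes>\<^bsub>G\<^esub> snd p)"

lemma power_monoid_simps [simp]:
  "carrier (\<P>\<^sub>f\<^sub>i\<^sub>n S) = {A. A \<subseteq> S \<and> finite A \<and> A \<noteq> {}}"
  "A \<otimes>\<^bsub>\<P>\<^sub>f\<^sub>i\<^sub>n S\<^esub> B = A + B"
  "\<one>\<^bsub>\<P>\<^sub>f\<^sub>i\<^sub>n S\<^esub> = {0}"
  by (simp_all add: power_monoid_def)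

lemma comm_monoid_power_monoid:
  assumes "numerical_monoid S"
  shows "comm_monoid (\<P>\<^sub>f\<^sub>i\<^sub>n S)"
proof (rule comm_monoidI)
  fix A B assume A: "A \<in> carrier (\<P>\<^sub>f\<^sub>i\<^sub>n S)" and B: "B \<in> carrier (\<P>\<^sub>f\<^sub>i\<^sub>n S)"
  have "A + B \<subseteq> S"
    using A B assms by (auto simp: set_plus_def numerical_monoid_def subset_iff)
  moreover have "finite (A + B)" using A B by (simp add: finite_set_plus)
  moreover have "A + B \<noteq> {}" using A B set_plus_intro[of _ A _ B] by fastforce
  ultimately show "A \<otimes>\<^bsub>\<P>\<^sub>f\<^sub>i\<^sub>n S\<^esub> B \<in> carrier (\<P>\<^sub>f\<^sub>i\<^sub>n S)" by simp
next
  show "\<one>\<^bsub>\<P>\<^sub>f\<^sub>i\<^sub>n S\<^esub> \<in> carrier (\<P>\<^sub>f\<^sub>i\<^sub>n S)" using assms by (simp add: numerical_monoid_def)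
next
  fix A show "\<one>\<^bsub>\<P>\<^sub>f\<^sub>i\<^sub>n S\<^esub> \<otimes>\<^bsub>\<P>\<^sub>f\<^sub>i\<^sub>n S\<^esub> A = A" by (simp add: set_plus_def)
qed (simp_all only: power_monoid_simps ac_simps)

text \<open>Hence the condition \<open>P \<notin> Units\<close> in the definition of prime elements in HOL-Algebra
  says that \<open>P \<noteq> {0}\<close>.\<close>

lemma Units_power_monoid:
  assumes "numerical_monoid S"
  shows "Units (\<P>\<^sub>f\<^sub>i\<^sub>n S) = {{0}}"
proof
  show "{{0}} \<subseteq> Units (\<P>\<^sub>f\<^sub>i\<^sub>n S)"
    using assms by (auto simp: Units_def set_plus_def numerical_monoid_def)
  show "Units (\<P>\<^sub>f\<^sub>i\<^sub>n S) \<subseteq> {{0}}"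
  proof
    fix A assume "A \<in> Units (\<P>\<^sub>f\<^sub>i\<^sub>n S)"
    then obtain B where A: "A \<noteq> {}" and B: "B \<noteq> {}" and AB: "A + B = {0}"
      by (auto simp: Units_def)
    have "a = 0" if "a \<in> A" for a
    proof -
      obtain b where "b \<in> B" using B by blast
      with that have "a + b \<in> A + B" by (rule set_plus_intro)
      with AB show ?thesis by simp
    qed
    with A show "A \<in> {{0}}" by blast
  qed
qed

end

theory Submission
  imports Defs
begin

text \<open>Let \<open>F\<close> be the Frobenius number of \<open>S\<close>. A set \<open>F + P\<close> with \<open>0 \<notin> P\<close> lies in \<open>S\<close>, but \<open>P\<close> does
  not divide it in the power monoid, since the cofactor would have minimum \<open>F \<notin> S\<close>.

  (1) If \<open>0 \<notin> P\<close>, then \<open>P\<close> divides \<open>(F + P) + (F + P)\<close> but not \<open>F + P\<close>. If \<open>0 \<in> P\<close> and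
  \<open>M = max P\<close>, then \<open>M \<ge> 2\<close> because \<open>1 \<notin> S\<close>; a long interval starting at \<open>N > F\<close> with the point
  \<open>N + M\<close> removed is not divisible by \<open>P\<close>, while its double is an interval and is divisible by
  \<open>P\<close>.

  (2) The singletons form a copy of \<open>S\<close>, and \<open>{a b}\<close> is a multiple of both \<open>{a}\<close> and \<open>{b}\<close>, so
  all of them lie in one summand, say \<open>H1\<close>. Shifting by \<open>F\<close> as above shows that every element of
  \<open>H2\<close> contains \<open>0\<close>. Hence \<open>{N, N + 1}\<close>, for \<open>N > F\<close>, has trivial component in \<open>H2\<close>, so \<open>H1\<close>
  contains intervals \<open>I\<close>, \<open>J\<close> of prescribed length, and any \<open>A \<in> H2\<close> satisfies \<open>A + I = J\<close> for
  suitable ones; uniqueness forces \<open>A = {0}\<close>.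

  (3) The singletons are exactly the cancellative elements, so an isomorphism of power monoids
  induces an isomorphism \<open>f\<close> from \<open>S'\<close> to \<open>S\<close>. From \<open>a f(b) = f(a b) = b f(a)\<close> and
  \<open>gcd S = gcd S' = 1\<close> it follows that \<open>f\<close> is the identity.\<close>

section \<open>Sumsets of sets of natural numbers\<close>

lemma set_plus_singletons: "{a} + {b} = {a + b}"
  by (auto simp: set_plus_def)

lemma singleton_set_plus: "{a} + B = (+) a ` B"
  by (auto simp: set_plus_def)

lemma pair_plus_atLeastAtMost:
  fixes a m n :: nat
  assumes "m \<le> n"
  shows "{a, a + 1} + {m..n} = {a + m..a + n + 1}"
proof -
  have "{a, a + 1} + {m..n} = (+) a ` {m..n} \<union> (+) (a + 1) ` {m..n}"
    unfolding set_plus_def by blast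
  also have "\<dots> = {a + m..a + n + 1}"
    unfolding image_add_atLeastAtMost using assms by auto
  finally show ?thesis .
qed

lemma set_plus_eq_empty_iff: "A + B = {} \<longleftrightarrow> A = {} \<or> B = {}"
  by (auto simp: set_plus_def)

lemma set_plus_eq_singletonD:
  fixes A B :: "nat set"
  assumes "A + B = {n}" "A \<noteq> {}" "B \<noteq> {}"
  obtains a b where "A = {a}" "B = {b}" "a + b = n"
proof -
  from assms obtain a b where ab: "a \<in> A" "b \<in> B" by blast
  have *: "x + y = n" if "x \<in> A" "y \<in> B" for x y
    using set_plus_intro[OF that] assms(1) by simp
  have "x = a" if "x \<in> A" for x using *[OF that ab(2)] *[OF ab] by simp
  then have "A = {a}" using ab by blast
  moreover have "y = b" if "y \<in> B" for y using *[OF ab(1) that] *[OF ab] by simp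
  then have "B = {b}" using ab by blast
  ultimately show thesis using that * ab by blast
qed

lemma singleton_plus_eq_singletonD:
  fixes A :: "nat set"
  assumes "{m} + A = {m + n}"
  shows "A = {n}"
proof -
  have "A \<noteq> {}" using assms by (auto simp: set_plus_def)
  then show ?thesis using set_plus_eq_singletonD[OF assms] by auto
qed

lemma Min_set_plus:
  fixes A B :: "nat set"
  assumes "finite A" "A \<noteq> {}" "finite B" "B \<noteq> {}"
  shows "Min (A + B) = Min A + Min B"
proof (rule Min_eqI)
  show "Min A + Min B \<in> A + B" using assms by (intro set_plus_intro Min_in)
qed (use assms in \<open>auto simp: finite_set_plus elim!: set_plus_elim intro!: add_mono\<close>)

text \<open>The elements 0 and \<open>Max A\<close> already do all the work: 0 reaches the points up
  to \<open>k + d - Max A\<close>, and \<open>Max A\<close> reaches the rest, where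
  \<open>2 * Max A \<le> d\<close> keeps \<open>x - Max A\<close> above \<open>k\<close>.\<close>

lemma set_plus_atLeastAtMost:
  fixes A :: "nat set"
  assumes "finite A" "0 \<in> A" "2 * Max A \<le> d"
  shows "A + {k..k + d - Max A} = {k..k + d}"
proof
  show "A + {k..k + d - Max A} \<subseteq> {k..k + d}"
  proof
    fix x assume "x \<in> A + {k..k + d - Max A}"
    then obtain a c where ac: "x = a + c" "a \<in> A" "c \<in> {k..k + d - Max A}"
      by (rule set_plus_elim)
    have "a \<le> Max A" using ac assms by simp
    then show "x \<in> {k..k + d}" using ac assms(3) by auto
  qed
  show "{k..k + d} \<subseteq> A + {k..k + d - Max A}"
  proof
    fix x assume x: "x \<in> {k..k + d}"
    have "Max A \<in> A" using assms by (auto intro: Max_in)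
    then have "\<exists>a\<in>A. a \<le> x \<and> x - a \<in> {k..k + d - Max A}"
      using x assms by (cases "x \<le> k + d - Max A") (auto intro: bexI[of _ 0] bexI[of _ "Max A"])
    then show "x \<in> A + {k..k + d - Max A}"
      by (metis le_add_diff_inverse set_plus_intro)
  qed
qed

section \<open>Numerical monoids and their Frobenius numbers\<close>

lemma numerical_monoid_mult:
  assumes "numerical_monoid S" "a \<in> S"
  shows "k * a \<in> S"
  using assms by (induction k) (auto simp: numerical_monoid_def)

text \<open>The least positive difference \<open>d\<close> of two elements divides every element,
  because a nonzero remainder would be a smaller difference. As the gcd is 1, this forces
  \<open>d = 1\<close>.\<close>

lemma numerical_monoid_consecutive:
  assumes S: "numerical_monoid S"
  obtains s where "s \<in> S" "s + 1 \<in> S"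
proof -
  define gap where "gap d \<longleftrightarrow> d > 0 \<and> (\<exists>s\<in>S. s + d \<in> S)" for d
  define d where "d = (LEAST d. gap d)"
  have "\<exists>a\<in>S. a > 0"
  proof (rule ccontr)
    assume "\<not> (\<exists>a\<in>S. a > 0)"
    then have "Gcd S = 0" by auto
    then show False using S by (metis numerical_monoid_def zero_neq_one)
  qed
  then have "\<exists>d. gap d" using S by (force simp: gap_def numerical_monoid_def)
  then have "gap d" unfolding d_def by (metis LeastI)
  then obtain s where s: "s \<in> S" "s + d \<in> S" "d > 0" by (auto simp: gap_def)
  have "d dvd a" if "a \<in> S" for a
  proof (rule ccontr)
    assume "\<not> d dvd a"
    then have r: "a mod d > 0" by (simp add: dvd_eq_mod_eq_0)
    \<comment> \<open>Both \<open>(a div d) * (s + d)\<close> and \<open>(a div d) * s + a\<close>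
      lie in \<open>S\<close>, and they differ by exactly the remainder.\<close>
    have eq: "(a div d) * (s + d) + a mod d = (a div d) * s + a"
      by (simp add: algebra_simps)
    have "(a div d) * s + a \<in> S"
      using S s that numerical_monoid_mult[OF S] by (simp add: numerical_monoid_def)
    then have "gap (a mod d)"
      unfolding gap_def using r eq numerical_monoid_mult[OF S s(2)] by metis
    then have "d \<le> a mod d" unfolding d_def by (rule Least_le)
    then show False using s(3) by (meson mod_less_divisor not_le)
  qed
  then have "d dvd Gcd S" by (rule Gcd_greatest)
  then have "d = 1" using S by (simp add: numerical_monoid_def)
  then show thesis using that s by blast
qed

lemma numerical_monoid_cofinite:
  assumes S: "numerical_monoid S"
  obtains N where "\<And>n. n \<ge> N \<Longrightarrow> n \<in> S"
proof -
  obtain s where s: "s \<in> S" "s + 1 \<in> S" by (rule numerical_monoid_consecutive[OF S])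
  \<comment> \<open>Write \<open>n = q * s + r\<close> with \<open>r < s \<le> q\<close>; trading
    \<open>r\<close> of the \<open>q\<close> copies of \<open>s\<close> for copies of
    \<open>s + 1\<close> absorbs the remainder.\<close>
  have "n \<in> S" if n: "n \<ge> s * s" for n
  proof (cases "s = 0")
    case True
    then show ?thesis using numerical_monoid_mult[OF S s(2), of n] by simp
  next
    case False
    define q r where "q = n div s" and "r = n mod s"
    have "s \<le> q" using n False by (simp add: q_def less_eq_div_iff_mult_less_eq)
    moreover have "r < s" using False by (simp add: r_def)
    ultimately have "r \<le> q" by simp
    then obtain t where t: "q = r + t" by (metis le_Suc_ex)
    have "n = q * s + r" by (simp add: q_def r_def)
    also have "\<dots> = t * s + r * (s + 1)" by (simp add: t algebra_simps)
    also have "\<dots> \<in> S"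
      using S s numerical_monoid_mult[OF S] by (simp only: numerical_monoid_def)
    finally show ?thesis .
  qed
  then show thesis by (rule that)
qed

lemma numerical_monoid_Frobenius:
  assumes S: "numerical_monoid S" and ne: "S \<noteq> UNIV"
  obtains F where "F > 0" "F \<notin> S" "\<And>n. n > F \<Longrightarrow> n \<in> S"
proof -
  obtain N where N: "\<And>n. n \<ge> N \<Longrightarrow> n \<in> S" using numerical_monoid_cofinite[OF S] by blast
  then have "- S \<subseteq> {..<N}" by (auto simp: not_le[symmetric])
  then have fin: "finite (- S)" by (rule finite_subset) simp
  have "- S \<noteq> {}" using ne by auto
  then have "Max (- S) \<in> - S" using fin by (rule Max_in[rotated])
  moreover have "0 \<in> S" using S by (simp add: numerical_monoid_def)
  moreover have "n \<in> S" if "n > Max (- S)" for n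
    using Max_ge[OF fin, of n] that by (meson ComplI not_le)
  ultimately show thesis using that[of "Max (- S)"] by (metis ComplD gr0I)
qed

lemma one_notin_numerical_monoid:
  assumes "numerical_monoid S" "S \<noteq> UNIV"
  shows "1 \<notin> S"
  using assms numerical_monoid_mult[of S 1] by force

section \<open>Absence of prime elements\<close>

lemma power_monoid_no_primes:
  assumes S: "numerical_monoid S" and ne: "S \<noteq> UNIV" and P: "P \<in> carrier (\<P>\<^sub>f\<^sub>i\<^sub>n S)"
  shows "\<not> Divisibility.prime (\<P>\<^sub>f\<^sub>i\<^sub>n S) P"
proof
  assume "Divisibility.prime (\<P>\<^sub>f\<^sub>i\<^sub>n S) P"
  note prime_unfolded = this[unfolded Divisibility.prime_def factor_def Units_power_monoid[OF S]
      power_monoid_simps(2)]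
  have P0: "P \<noteq> {0}" using prime_unfolded by blast
  \<comment> \<open>For a square \<open>A + A\<close> both alternatives of primality say the same:
    \<open>P\<close> divides \<open>A\<close>.\<close>
  have prime: "\<exists>C\<in>carrier (\<P>\<^sub>f\<^sub>i\<^sub>n S). A = P + C"
    if "A \<in> carrier (\<P>\<^sub>f\<^sub>i\<^sub>n S)" "C \<in> carrier (\<P>\<^sub>f\<^sub>i\<^sub>n S)" "A + A = P + C" for A C
    using prime_unfolded that by blast
  obtain F where F: "F > 0" "F \<notin> S" "\<And>n. n > F \<Longrightarrow> n \<in> S"
    using numerical_monoid_Frobenius[OF S ne] by blast
  have fin: "finite P" "P \<noteq> {}" using P by auto
  show False
  proof (cases "0 \<in> P")
    case False
    have "\<exists>C\<in>carrier (\<P>\<^sub>f\<^sub>i\<^sub>n S). {F} + P = P + C"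
    proof (rule prime)
      have "F + p \<in> S" if "p \<in> P" for p
        using that False F(3)[of "F + p"] by (metis gr0I less_add_same_cancel1)
      then show "{F} + P \<in> carrier (\<P>\<^sub>f\<^sub>i\<^sub>n S)" 
        using fin by (auto simp: finite_set_plus set_plus_eq_empty_iff elim!: set_plus_elim)
      show "{2 * F} + P \<in> carrier (\<P>\<^sub>f\<^sub>i\<^sub>n S)" 
        using fin F by (auto simp: finite_set_plus set_plus_eq_empty_iff elim!: set_plus_elim)
      have "{F} + {F} = {2 * F}" by (simp add: set_plus_singletons mult_2)
      then show "{F} + P + ({F} + P) = P + ({2 * F} + P)" by (metis add.assoc add.commute)
    qed
    then obtain C where C: "C \<subseteq> S" "finite C" "C \<noteq> {}" "{F} + P = P + C" by auto
    \<comment> \<open>Comparing minima forces the cofactor to contain the gap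
      \<open>F\<close>.\<close>
    have "Min ({F} + P) = F + Min P" using fin by (subst Min_set_plus) auto
    moreover have "Min (P + C) = Min P + Min C" using fin C by (intro Min_set_plus) auto
    ultimately have "Min C = F" using C(4) by simp
    then have "F \<in> C" using C Min_in by blast
    then show False using C F by blast
  next
    case True
    define M where "M = Max P"
    have M: "M \<in> P" using fin by (simp add: M_def)
    have "M \<noteq> 0" using P0 True fin unfolding M_def
      by (metis Max_ge insertI1 le_zero_eq subsetI subset_singleton_iff equals0D)
    moreover have "M \<noteq> 1" using M P one_notin_numerical_monoid[OF S ne] by auto
    ultimately have M2: "M \<ge> 2" by simp
    \<comment> \<open>Starting above \<open>F\<close> keeps the interval inside \<open>S\<close>,
      and length \<open>2 * M\<close> is enough for \<open>P\<close> to be absorbed by intervals.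
      The hole at \<open>N + M\<close> is the point that a cofactor containing \<open>N\<close>
      would be forced to fill.\<close>
    define N D where "N = F + 1" and "D = 2 * M"
    define A where "A = {N..N + D} - {N + M}"
    have NA: "N \<in> A" using M2 by (auto simp: A_def)
    have "\<exists>C\<in>carrier (\<P>\<^sub>f\<^sub>i\<^sub>n S). A = P + C"
    proof (rule prime)
      show "A \<in> carrier (\<P>\<^sub>f\<^sub>i\<^sub>n S)"
        using F(3) NA by (force simp: A_def N_def)
      show "{2 * N..2 * N + 2 * D - M} \<in> carrier (\<P>\<^sub>f\<^sub>i\<^sub>n S)"
        using F(3) M2 by (auto simp: N_def D_def)
      have "A + A = {2 * N..2 * N + 2 * D}"
      proof
        show "A + A \<subseteq> {2 * N..2 * N + 2 * D}" by (auto simp: A_def set_plus_def)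
        show "{2 * N..2 * N + 2 * D} \<subseteq> A + A"
        proof
          fix x assume x: "x \<in> {2 * N..2 * N + 2 * D}"
          then obtain t where t: "x = 2 * N + t" "t \<le> 2 * D"
            by (metis add_le_cancel_left atLeastAtMost_iff le_Suc_ex)
          \<comment> \<open>The hole excludes \<open>M\<close> as a summand. Only the sums
            \<open>M\<close> and \<open>D + M\<close> need care; they are rewritten as
            \<open>1 + (M - 1)\<close> and \<open>(D - 1) + (M + 1)\<close>, which avoid
            \<open>M\<close> because \<open>M \<ge> 2\<close>.\<close>
          have "\<exists>i j. t = i + j \<and> i \<le> D \<and> j \<le> D \<and> i \<noteq> M \<and> j \<noteq> M"
          proof -
            consider "t = M" | "t \<noteq> M" "t \<le> D" | "t > D" "t \<noteq> D + M" | "t = D + M"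
              by linarith
            then show ?thesis
            proof cases
              case 1
              then show ?thesis using M2 by (intro exI[of _ 1] exI[of _ "M - 1"]) (auto simp: D_def)
            next
              case 2
              then show ?thesis using M2 by (intro exI[of _ 0] exI[of _ t]) auto
            next
              case 3
              then show ?thesis using M2 t
                by (intro exI[of _ D] exI[of _ "t - D"]) (auto simp: D_def)
            next
              case 4
              then show ?thesis using M2 
                by (intro exI[of _ "D - 1"] exI[of _ "M + 1"]) (auto simp: D_def)
            qed
          qed
          then obtain i j where ij: "t = i + j" "i \<le> D" "j \<le> D" "i \<noteq> M" "j \<noteq> M" by blast
          then have "(N + i) + (N + j) \<in> A + A" by (intro set_plus_intro) (auto simp: A_def)
          moreover have "x = (N + i) + (N + j)" using ij t by simp
          ultimately show "x \<in> A + A" by simp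
        qed
      qed
      also have "\<dots> = P + {2 * N..2 * N + 2 * D - M}"
        unfolding M_def using fin True
        by (intro set_plus_atLeastAtMost[symmetric]) (auto simp: D_def M_def)
      finally show "A + A = P + {2 * N..2 * N + 2 * D - M}" .
    qed
    then obtain C where C: "A = P + C" by auto
    have "C \<subseteq> A" unfolding C using True by (rule set_zero_plus2)
    obtain p c where pc: "N = p + c" "p \<in> P" "c \<in> C"
      using NA unfolding C by (rule set_plus_elim)
    \<comment> \<open>Since \<open>N\<close> is the least element of \<open>A\<close>, the summand
      \<open>p\<close> must be 0 and \<open>c = N\<close>.\<close>
    then have "N \<le> c" using \<open>C \<subseteq> A\<close> by (auto simp: A_def)
    then have "N \<in> C" using pc by simp
    then have "M + N \<in> A" unfolding C using M by (intro set_plus_intro)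
    then show False by (simp add: A_def)
  qed
qed

section \<open>Direct decompositions\<close>

lemma is_direct_sum_split:
  assumes "is_direct_sum G H1 H2" "h \<in> carrier G"
  obtains x y where "x \<in> H1" "y \<in> H2" "h = x \<otimes>\<^bsub>G\<^esub> y"
proof -
  obtain p where "p \<in> H1 \<times> H2" "h = fst p \<otimes>\<^bsub>G\<^esub> snd p"
    using assms unfolding is_direct_sum_def by blast
  then show thesis using that by auto
qed

lemma is_direct_sum_unique:
  assumes "is_direct_sum G H1 H2"
    and "x \<in> H1" "y \<in> H2" "x' \<in> H1" "y' \<in> H2" "x \<otimes>\<^bsub>G\<^esub> y = x' \<otimes>\<^bsub>G\<^esub> y'" "x \<otimes>\<^bsub>G\<^esub> y \<in> carrier G"
  shows "x = x'" "y = y'"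
proof -
  have "\<exists>!p. p \<in> H1 \<times> H2 \<and> x \<otimes>\<^bsub>G\<^esub> y = fst p \<otimes>\<^bsub>G\<^esub> snd p"
    using assms by (simp add: is_direct_sum_def)
  then have "(x, y) = (x', y')" using assms by (metis SigmaI fst_conv snd_conv)
  then show "x = x'" "y = y'" by auto
qed

lemma is_direct_sum_commute:
  assumes "comm_monoid G" "is_direct_sum G H1 H2"
  shows "is_direct_sum G H2 H1"
proof -
  interpret comm_monoid G by fact
  have sub: "H1 \<subseteq> carrier G" "H2 \<subseteq> carrier G"
    using assms by (auto simp: is_direct_sum_def submonoid_def)
  have comm: "y \<otimes>\<^bsub>G\<^esub> x = x \<otimes>\<^bsub>G\<^esub> y" if "x \<in> H1" "y \<in> H2" for x y
    using that sub by (intro m_comm) auto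
  have "\<exists>!p. p \<in> H2 \<times> H1 \<and> h = fst p \<otimes>\<^bsub>G\<^esub> snd p" if h: "h \<in> carrier G" for h
  proof -
    obtain x y where xy: "x \<in> H1" "y \<in> H2" "h = x \<otimes>\<^bsub>G\<^esub> y"
      by (rule is_direct_sum_split[OF assms(2) h])
    show ?thesis
    proof (rule ex1I[of _ "(y, x)"])
      fix p assume p: "p \<in> H2 \<times> H1 \<and> h = fst p \<otimes>\<^bsub>G\<^esub> snd p"
      then have "x \<otimes>\<^bsub>G\<^esub> y = snd p \<otimes>\<^bsub>G\<^esub> fst p" using xy(3) comm by auto
      then have "x = snd p" "y = fst p"
        using is_direct_sum_unique[OF assms(2) xy(1,2), of "snd p" "fst p"] p h xy(3) by auto
      then show "p = (y, x)" by simp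
    qed (use xy comm in simp)
  qed
  then show ?thesis using assms by (simp add: is_direct_sum_def)
qed

text \<open>The nonzero singleton breaks the symmetry between the summands: it draws all singletons,
  and then long intervals, into \<open>H1\<close>.\<close>

lemma power_monoid_summand_trivial:
  assumes S: "numerical_monoid S" and ne: "S \<noteq> UNIV"
    and dir: "is_direct_sum (\<P>\<^sub>f\<^sub>i\<^sub>n S) H1 H2"
    and a: "{a} \<in> H1" "a > 0"
  shows "H2 = {{0}}"
proof -
  interpret comm_monoid "\<P>\<^sub>f\<^sub>i\<^sub>n S" by (rule comm_monoid_power_monoid[OF S])
  have sub: "submonoid H1 (\<P>\<^sub>f\<^sub>i\<^sub>n S)" "submonoid H2 (\<P>\<^sub>f\<^sub>i\<^sub>n S)"
    using dir by (auto simp: is_direct_sum_def)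
  have zero: "{0} \<in> H1" "{0} \<in> H2" using sub[THEN submonoid.one_closed] by auto
  have plus: "X + Y \<in> H1" if "X \<in> H1" "Y \<in> H1" for X Y
    using submonoid.m_closed[OF sub(1) that] by simp
  have plus2: "X + Y \<in> H2" if "X \<in> H2" "Y \<in> H2" for X Y
    using submonoid.m_closed[OF sub(2) that] by simp
  have carr: "X \<in> carrier (\<P>\<^sub>f\<^sub>i\<^sub>n S)" if "X \<in> H1 \<or> X \<in> H2" for X
    using that sub[THEN submonoid.subset] by blast
  have split: "\<exists>X\<in>H1. \<exists>Y\<in>H2. Z = X + Y" if "Z \<in> carrier (\<P>\<^sub>f\<^sub>i\<^sub>n S)" for Z
    using is_direct_sum_split[OF dir that] by (metis power_monoid_simps(2))
  have unique: "X = X'" "Y = Y'" if "X \<in> H1" "Y \<in> H2" "X' \<in> H1" "Y' \<in> H2" "X + Y = X' + Y'"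
    for X Y X' Y'
  proof -
    have "X \<otimes>\<^bsub>\<P>\<^sub>f\<^sub>i\<^sub>n S\<^esub> Y \<in> carrier (\<P>\<^sub>f\<^sub>i\<^sub>n S)" using that carr by (intro m_closed) auto
    then show "X = X'" "Y = Y'"
      using is_direct_sum_unique[OF dir that(1-4)] that(5) by auto
  qed
  \<comment> \<open>The singleton of \<open>a * b\<close> is a multiple of \<open>{a}\<close> and of
    \<open>{b}\<close>, hence lies in both summands, and uniqueness makes it
    \<open>{0}\<close>.\<close>
  have H2_singleton: "b = 0" if b: "{b} \<in> H2" for b
  proof -
    have "{k * a} \<in> H1" for k
    proof (induction k)
      case (Suc k)
      then show ?case using plus[OF a(1) Suc] by (simp add: set_plus_singletons)
    qed (use zero in simp)
    moreover have "{k * b} \<in> H2" for k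
    proof (induction k)
      case (Suc k)
      then show ?case using plus2[OF b Suc] by (simp add: set_plus_singletons)
    qed (use zero in simp)
    moreover have "{b * a} + {0} = {0} + {a * b}" by (simp add: set_plus_singletons)
    ultimately have "{b * a} = {0}" using unique(1) zero by blast
    then show ?thesis using a by simp
  qed
  have H1_singleton: "{n} \<in> H1" if "n \<in> S" for n
  proof -
    from split[of "{n}"] that obtain X Y where XY: "X \<in> H1" "Y \<in> H2" "X + Y = {n}" by auto
    moreover have "X \<noteq> {}" "Y \<noteq> {}" using carr XY by auto
    ultimately obtain x y where "X = {x}" "Y = {y}" "x + y = n"
      by (meson set_plus_eq_singletonD)
    then show ?thesis using XY H2_singleton by force
  qed
  obtain F where F: "F > 0" "F \<notin> S" "\<And>n. n > F \<Longrightarrow> n \<in> S"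
    using numerical_monoid_Frobenius[OF S ne] by blast
  have H2_zero: "0 \<in> A" if A: "A \<in> H2" for A
  proof (rule ccontr)
    assume A0: "0 \<notin> A"
    have "F + x \<in> S" if "x \<in> A" for x
      using that A0 F(3)[of "F + x"] by (metis gr0I less_add_same_cancel1)
    then have "{F} + A \<in> carrier (\<P>\<^sub>f\<^sub>i\<^sub>n S)"
      using carr[of A] A by (auto simp: finite_set_plus set_plus_eq_empty_iff elim!: set_plus_elim)
    then obtain X Y where XY: "X \<in> H1" "Y \<in> H2" "{F} + A = X + Y" using split by blast
    \<comment> \<open>Although \<open>{F}\<close> is not in the monoid, \<open>{N}\<close> and
      \<open>{N + F}\<close> are. Adding \<open>{N}\<close> therefore turns the equation into two
      genuine decompositions, whose \<open>H1\<close> components must agree.\<close>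
    define N where "N = F + 1"
    have N: "{N} \<in> H1" "{N + F} \<in> H1" using F by (auto simp: N_def intro!: H1_singleton)
    have "{N} + X + Y = {N + F} + A"
      using XY(3) by (metis add.assoc set_plus_singletons)
    then have "{N} + X = {N + F}" using unique(1) plus XY N A by blast
    then have "X = {F}" by (rule singleton_plus_eq_singletonD)
    then show False using carr XY F by auto
  qed
  define N where "N = F + 1"
  have "{N, N + 1} \<in> carrier (\<P>\<^sub>f\<^sub>i\<^sub>n S)" using F by (auto simp: N_def)
  then obtain X Y where XY: "X \<in> H1" "Y \<in> H2" "{N, N + 1} = X + Y" using split by blast
  obtain x where x: "x \<in> X" using XY carr[of X] by auto
  \<comment> \<open>Both \<open>x\<close> and \<open>x + y\<close> lie in \<open>{N, N + 1}\<close>,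
    so \<open>y\<close> is 0 or 1, and 1 is not in \<open>S\<close>.\<close>
  have "y = 0" if y: "y \<in> Y" for y
  proof -
    have "y \<noteq> 1" using y XY carr one_notin_numerical_monoid[OF S ne] by auto
    moreover have "x + y \<in> {N, N + 1}" "x + 0 \<in> {N, N + 1}"
      unfolding XY(3) using x y H2_zero[OF XY(2)] by (simp_all only: set_plus_intro)
    ultimately show ?thesis by auto
  qed
  then have "Y = {0}" using H2_zero XY by blast
  then have pair: "{N, N + 1} \<in> H1" using XY by (simp add: set_plus_def)
  \<comment> \<open>This is the \<open>k\<close>-fold sum of the pair, so length \<open>k\<close>
    comes with left endpoint \<open>k * N\<close>.\<close>
  have interval: "{k * N..k * N + k} \<in> H1" for k
  proof (induction k)
    case (Suc k)
    have "{N, N + 1} + {k * N..k * N + k} = {Suc k * N..Suc k * N + Suc k}"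
      using pair_plus_atLeastAtMost[of "k * N" "k * N + k" N] by simp
    then show ?case using plus[OF pair Suc] by simp
  qed (use zero in simp)
  have "A = {0}" if A: "A \<in> H2" for A
  proof -
    define M where "M = Max A"
    \<comment> \<open>Absorbing \<open>A\<close> requires intervals of lengths \<open>M\<close> and
      \<open>2 * M\<close> with a common left endpoint. The shorter one is the \<open>M\<close>-fold
      sum of the pair, translated by \<open>M * N\<close>.\<close>
    define C D where "C = {2 * M * N..2 * M * N + 2 * M - M}"
      and "D = {2 * M * N..2 * M * N + 2 * M}"
    have "{M * N} \<in> H1"
      using F by (intro H1_singleton numerical_monoid_mult[OF S]) (simp add: N_def)
    then have "{M * N} + {M * N..M * N + M} \<in> H1" using interval by (rule plus)
    then have C: "C \<in> H1" by (simp add: C_def singleton_set_plus mult_2 mult_2_right algebra_simps)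
    have D: "D \<in> H1" unfolding D_def by (rule interval)
    have "A + C = D"
      unfolding C_def D_def M_def using carr[of A] A H2_zero by (intro set_plus_atLeastAtMost) auto
    then have "C + A = D + {0}" by (simp add: add.commute singleton_set_plus)
    then show ?thesis by (rule unique(2)[OF C A D zero(2)])
  qed
  then show ?thesis using zero by blast
qed

text \<open>A nonzero singleton splits only into singletons, one of them nonzero; the summand
  containing it takes the role of \<open>H1\<close> in
  \<open>power_monoid_summand_trivial\<close>.\<close>

lemma power_monoid_directly_indecomposable:
  assumes S: "numerical_monoid S" and ne: "S \<noteq> UNIV"
    and dir: "is_direct_sum (\<P>\<^sub>f\<^sub>i\<^sub>n S) H1 H2"
  shows "H1 = {{0}} \<or> H2 = {{0}}"
proof -
  obtain F where F: "F > 0" "F \<notin> S" "\<And>n. n > F \<Longrightarrow> n \<in> S"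
    using numerical_monoid_Frobenius[OF S ne] by blast
  define n where "n = F + 1"
  have "{n} \<in> carrier (\<P>\<^sub>f\<^sub>i\<^sub>n S)" using F by (simp add: n_def)
  then obtain X Y where XY: "X \<in> H1" "Y \<in> H2" "X + Y = {n}"
    using is_direct_sum_split[OF dir] by (metis power_monoid_simps(2))
  have "X \<noteq> {}" "Y \<noteq> {}"
    using XY by (auto simp: set_plus_def)
  then obtain x y where xy: "X = {x}" "Y = {y}" "x + y = n"
    using XY by (meson set_plus_eq_singletonD)
  then consider "x > 0" | "y > 0" unfolding n_def by linarith
  then show ?thesis
  proof cases
    case 1
    then show ?thesis using power_monoid_summand_trivial[OF S ne dir] XY xy by blast
  next
    case 2
    have "is_direct_sum (\<P>\<^sub>f\<^sub>i\<^sub>n S) H2 H1"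
      by (rule is_direct_sum_commute[OF comm_monoid_power_monoid[OF S] dir])
    then show ?thesis using 2 power_monoid_summand_trivial[OF S ne] XY xy by blast
  qed
qed

section \<open>Cancellative elements and isomorphisms\<close>

text \<open>Being expressed through the operation alone, this property is transported by
  isomorphisms; in power monoids it recognises the singletons.\<close>

definition left_cancellative :: "('a, 'b) monoid_scheme \<Rightarrow> 'a \<Rightarrow> bool" where
  "left_cancellative G x \<longleftrightarrow>
     (\<forall>y\<in>carrier G. \<forall>z\<in>carrier G. x \<otimes>\<^bsub>G\<^esub> y = x \<otimes>\<^bsub>G\<^esub> z \<longrightarrow> y = z)"

lemma left_cancellative_iso:
  assumes phi: "\<phi> \<in> iso G H" and x: "x \<in> carrier G"
    and closed: "\<And>y. y \<in> carrier G \<Longrightarrow> x \<otimes>\<^bsub>G\<^esub> y \<in> carrier G"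
  shows "left_cancellative H (\<phi> x) \<longleftrightarrow> left_cancellative G x"
proof -
  have inj: "inj_on \<phi> (carrier G)" and surj: "\<phi> ` carrier G = carrier H"
    using phi by (auto simp: iso_def bij_betw_def)
  have hom: "\<phi> (x \<otimes>\<^bsub>G\<^esub> y) = \<phi> x \<otimes>\<^bsub>H\<^esub> \<phi> y" if "y \<in> carrier G" for y
    using phi x that by (auto simp: iso_def hom_def)
  have "left_cancellative H (\<phi> x) \<longleftrightarrow>
      (\<forall>y\<in>carrier G. \<forall>z\<in>carrier G. \<phi> (x \<otimes>\<^bsub>G\<^esub> y) = \<phi> (x \<otimes>\<^bsub>G\<^esub> z) \<longrightarrow> \<phi> y = \<phi> z)"
    unfolding left_cancellative_def surj[symmetric] by (simp add: hom)
  \<comment> \<open>By \<open>closed\<close> the products stay in the carrier, where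
    \<open>\<phi>\<close> is injective.\<close>
  also have "\<dots> \<longleftrightarrow> left_cancellative G x"
    using closed by (simp add: left_cancellative_def inj_on_eq_iff[OF inj])
  finally show ?thesis .
qed

text \<open>Translation is injective. Conversely, if \<open>A\<close> has two elements, deleting the
  midpoint of a long interval \<open>B\<close> does not change \<open>A + B\<close>.\<close>

lemma left_cancellative_power_monoid_iff:
  assumes S: "numerical_monoid S" and A: "A \<in> carrier (\<P>\<^sub>f\<^sub>i\<^sub>n S)"
  shows "left_cancellative (\<P>\<^sub>f\<^sub>i\<^sub>n S) A \<longleftrightarrow> (\<exists>n\<in>S. A = {n})"
proof
  assume "\<exists>n\<in>S. A = {n}"
  then obtain n where "A = {n}" by blast
  then show "left_cancellative (\<P>\<^sub>f\<^sub>i\<^sub>n S) A"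
    by (simp add: left_cancellative_def singleton_set_plus inj_image_eq_iff)
next
  assume canc: "left_cancellative (\<P>\<^sub>f\<^sub>i\<^sub>n S) A"
  obtain N where N: "\<And>n. n \<ge> N \<Longrightarrow> n \<in> S" using numerical_monoid_cofinite[OF S] by blast
  obtain a where a: "a \<in> A" using A by auto
  show "\<exists>n\<in>S. A = {n}"
  proof (rule ccontr)
    assume "\<not> (\<exists>n\<in>S. A = {n})"
    moreover have "A \<subseteq> S" using A by simp
    ultimately have two: "\<exists>c\<in>A. c \<noteq> b" if "b \<in> A" for b using that by blast
    define M where "M = Max A"
    have le: "b \<le> M" if "b \<in> A" for b using that A by (simp add: M_def)
    have "M > 0" using two[OF a] le a by (metis gr0I le_zero_eq)
    \<comment> \<open>The interval has radius \<open>M\<close> around \<open>x\<close>, so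
      \<open>b + x\<close> can be rewritten as \<open>c + (x + b - c)\<close> with
      \<open>c \<noteq> b\<close> without leaving \<open>B\<close> or using
      \<open>x\<close>.\<close>
    define x B where "x = N + M" and "B = {N..N + 2 * M}"
    have sub: "A + B \<subseteq> A + (B - {x})"
    proof
      fix s assume "s \<in> A + B"
      then obtain b y where bv: "b \<in> A" "y \<in> B" "s = b + y" by (auto elim: set_plus_elim)
      show "s \<in> A + (B - {x})"
      proof (cases "y = x")
        case False
        then show ?thesis using bv by (auto intro: set_plus_intro)
      next
        case True
        obtain c where c: "c \<in> A" "c \<noteq> b" using two bv by blast
        have "s = c + (s - c)" "s - c \<in> B - {x}"
          using bv c True le[of b] le[of c] by (auto simp: x_def B_def)
        then show ?thesis using c(1) by (metis set_plus_intro)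
      qed
    qed
    then have "A + B = A + (B - {x})" by (auto simp: set_plus_def)
    moreover have "B \<in> carrier (\<P>\<^sub>f\<^sub>i\<^sub>n S)" using N by (auto simp: B_def)
    moreover have "B - {x} \<in> carrier (\<P>\<^sub>f\<^sub>i\<^sub>n S)"
    proof -
      have "N \<in> B - {x}" using \<open>M > 0\<close> by (simp add: B_def x_def)
      then show ?thesis using N by (force simp: B_def)
    qed
    ultimately have "B = B - {x}" 
      using canc unfolding left_cancellative_def power_monoid_simps(2) by blast
    moreover have "x \<in> B" by (simp add: x_def B_def)
    ultimately show False by blast
  qed
qed

lemma numerical_monoid_iso_eq:
  assumes S: "numerical_monoid S" and S': "numerical_monoid S'"
    and f: "f ` S' = S" and add: "\<And>a b. a \<in> S' \<Longrightarrow> b \<in> S' \<Longrightarrow> f (a + b) = f a + f b"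
  shows "S = S'"
proof -
  have zero: "0 \<in> S'" using S' by (simp add: numerical_monoid_def)
  have f0: "f 0 = 0" using add[OF zero zero] by simp
  have mult: "f (k * a) = k * f a" if "a \<in> S'" for k a
  proof (induction k)
    case (Suc k)
    then show ?case using add[OF that numerical_monoid_mult[OF S' that], of k] by simp
  qed (simp add: f0)
  have "f b = b" if b: "b \<in> S'" for b
  proof -
    have "f b * a = b * f a" if "a \<in> S'" for a
      using mult[OF that, of b] mult[OF b, of a] by (simp add: mult.commute)
    \<comment> \<open>Letting \<open>a\<close> run through \<open>S'\<close> makes
      \<open>f a\<close> run through all of \<open>S\<close>; comparing the gcds of the two dilated
      monoids then yields \<open>f b = b\<close>.\<close>
    then have "(*) (f b) ` S' = (*) b ` S"
      unfolding f[symmetric] image_image by (rule image_cong[OF refl])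
    then have "f b * Gcd S' = b * Gcd S" by (metis Gcd_mult normalize_nat_def id_apply)
    then show ?thesis using S S' by (simp add: numerical_monoid_def)
  qed
  then show ?thesis using f by force
qed

lemma power_monoid_iso_eq:
  assumes S: "numerical_monoid S" and S': "numerical_monoid S'"
    and iso: "\<P>\<^sub>f\<^sub>i\<^sub>n S' \<cong> \<P>\<^sub>f\<^sub>i\<^sub>n S"
  shows "S = S'"
proof -
  interpret comm_monoid "\<P>\<^sub>f\<^sub>i\<^sub>n S'" by (rule comm_monoid_power_monoid[OF S'])
  obtain \<phi> where phi: "\<phi> \<in> iso (\<P>\<^sub>f\<^sub>i\<^sub>n S') (\<P>\<^sub>f\<^sub>i\<^sub>n S)" using iso by (auto simp: is_iso_def)
  then have surj: "\<phi> ` carrier (\<P>\<^sub>f\<^sub>i\<^sub>n S') = carrier (\<P>\<^sub>f\<^sub>i\<^sub>n S)"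
    and hom: "\<And>A B. A \<in> carrier (\<P>\<^sub>f\<^sub>i\<^sub>n S') \<Longrightarrow> B \<in> carrier (\<P>\<^sub>f\<^sub>i\<^sub>n S') \<Longrightarrow> \<phi> (A + B) = \<phi> A + \<phi> B"
    by (auto simp: iso_def bij_betw_def hom_def)
  \<comment> \<open>The forward direction gives surjectivity of \<open>f\<close> below; the backward
    one makes \<open>the_elem\<close> meaningful on the images of singletons.\<close>
  have singleton: "(\<exists>n\<in>S. \<phi> A = {n}) \<longleftrightarrow> (\<exists>n\<in>S'. A = {n})" if A: "A \<in> carrier (\<P>\<^sub>f\<^sub>i\<^sub>n S')" for A
  proof -
    have "\<phi> A \<in> carrier (\<P>\<^sub>f\<^sub>i\<^sub>n S)" using A surj by blast
    then show ?thesis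
      using left_cancellative_iso[OF phi A m_closed[OF A]] left_cancellative_power_monoid_iff S S' A
      by blast
  qed
  define f where "f n = the_elem (\<phi> {n})" for n
  have f: "f n \<in> S \<and> \<phi> {n} = {f n}" if "n \<in> S'" for n
  proof -
    have "{n} \<in> carrier (\<P>\<^sub>f\<^sub>i\<^sub>n S')" using that by simp
    moreover have "\<exists>m\<in>S'. {n} = {m}" using that by simp
    ultimately obtain m where "m \<in> S" "\<phi> {n} = {m}" using singleton by metis
    then show ?thesis by (simp add: f_def)
  qed
  show ?thesis
  proof (rule numerical_monoid_iso_eq[OF S S'])
    show "f ` S' = S"
    proof
      show "f ` S' \<subseteq> S" using f by blast
      show "S \<subseteq> f ` S'"
      proof
        fix s assume s: "s \<in> S"
        then have "{s} \<in> \<phi> ` carrier (\<P>\<^sub>f\<^sub>i\<^sub>n S')" unfolding surj by simp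
        then obtain A where A: "A \<in> carrier (\<P>\<^sub>f\<^sub>i\<^sub>n S')" "\<phi> A = {s}" by (metis imageE)
        then obtain n where n: "n \<in> S'" "A = {n}" using singleton[OF A(1)] s by blast
        then have "f n = s" using f[OF n(1)] A(2) by simp
        then show "s \<in> f ` S'" using n by blast
      qed
    qed
    show "f (a + b) = f a + f b" if "a \<in> S'" "b \<in> S'" for a b
    proof -
      have "\<phi> {a + b} = {f a + f b}"
        using hom[of "{a}" "{b}"] that f by (simp add: set_plus_singletons)
      then show ?thesis by (simp add: f_def)
    qed
  qed
qed

theorem theorem3p2:
  fixes S :: "nat set"
  assumes "numerical_monoid S" and "S \<noteq> UNIV"
  shows "\<not> (\<exists>P\<in>carrier (\<P>\<^sub>f\<^sub>i\<^sub>n S). Divisibility.prime (\<P>\<^sub>f\<^sub>i\<^sub>n S) P)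
    \<and> (\<forall>H1 H2. is_direct_sum (\<P>\<^sub>f\<^sub>i\<^sub>n S) H1 H2 \<longrightarrow> H1 = {{0}} \<or> H2 = {{0}})
    \<and> (\<forall>S'. numerical_monoid S' \<and> \<P>\<^sub>f\<^sub>i\<^sub>n S' \<cong> \<P>\<^sub>f\<^sub>i\<^sub>n S \<longrightarrow> S = S')"
  using power_monoid_no_primes[OF assms] power_monoid_directly_indecomposable[OF assms]
    power_monoid_iso_eq[OF assms(1)] by blast

end
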